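(* For every symmetric $0,1$-matrix $M$ and every natural number $k$, if $\mathrm{stw}(M)\leq k$, then $M$ has no $9k$-wide division.
   Context: Let $M$ be a symmetric $n\times n$ $0,1$-matrix with rows $r_1,\dots,r_n$ and columns $c_1,\dots,c_n$. A symmetric partition of $M$ is a pair $(\mathcal R,\mathcal C)$ with $\mathcal R$ a partition of the rows and $\mathcal C$ a partition of the columns such that $r_i,r_j$ lie in the same part iff $c_i,c_j$ do; each row part $R$ has a symmetric column part. The zone $R\cap C$ is the submatrix with rows $R$ and columns $C$; it is non-constant if it contains two distinct entries. A symmetric partition sequence of $M$ is a sequence of symmetric partitions starting with the partition into singletons, ending with one row part and one column part, each obtained from the previous one by merging two row parts and the two symmetric column parts. The span of a set of columns (rows) is the set of columns (rows) with index between its minimum and maximum index; two sets conflict if their spans intersect. The stretch value of a row part $R$ is the number of column parts conflicting with the union of all column parts $C$ such that $C$ is the symmetric of $R$ or $R\cap C$ is non-constant; symmetrically for column parts; the stretch value of a partition is the maximum over its parts. $\mathrm{stw}(M)$ is the minimum over symmetric partition sequences of the maximum stretch value of a partition in the sequence. A division is a symmetric partition whose parts consist of consecutive rows (columns), written $(R_1,\dots,R_p)$, $(C_1,\dots,C_p)$ in order, $C_i$ symmetric to $R_i$. A row part $R_i$ is $k$-wide if for every $k$ consecutive column parts $C_j,\dots,C_{j+k-1}$ with $j\le i\le j+k-1$, the submatrix with rows $R_i$ and all columns outside $C_j\cup\dots\cup C_{j+k-1}$ has at least $k$ distinct rows; symmetrically for column parts. A division is $k$-wide if all its row and column parts are 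$k$-wide.
   Formalization: A division counts as k-wide only if it has at least k parts; read literally, a division with fewer than k parts is vacuously k-wide, so the one-part division of a 1×1 matrix (stw = 1, k = 1) would refute the claim. *)

theory Defs
  imports
    "Jordan_Normal_Form.DL_Submatrix"
    "HOL-Library.Disjoint_Sets"
    "HOL-Library.Extended_Nat"
begin

text \<open>
  Rows and columns are identified with their indices, which start at 0. A row part and a column
  part are both sets of indices, and a partition of the rows and columns is a pair
  (row parts, column parts).
\<close>

definition zero_one_mat :: "'a :: zero_neq_one mat \<Rightarrow> bool" where
  "zero_one_mat M \<longleftrightarrow> elements_mat M \<subseteq> {0, 1}"

definition symmetric_mat :: "'a mat \<Rightarrow> bool" where
  "symmetric_mat M \<longleftrightarrow> transpose_mat M = M"

text \<open>The column part symmetric to \<open>R\<close> consists of the columns with the same indices as the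
  rows of \<open>R\<close>.\<close>

definition symmetric_to :: "nat set \<Rightarrow> nat set \<Rightarrow> bool" where
  "symmetric_to R C \<longleftrightarrow> C = R"

type_synonym mat_partition = "nat set set \<times> nat set set"

definition symmetric_partition :: "nat \<Rightarrow> mat_partition \<Rightarrow> bool" where
  "symmetric_partition n P \<longleftrightarrow>
     partition_on {..<n} (fst P) \<and> partition_on {..<n} (snd P) \<and>
     (\<forall>i<n. \<forall>j<n. (\<exists>R\<in>fst P. i \<in> R \<and> j \<in> R) \<longleftrightarrow> (\<exists>C\<in>snd P. i \<in> C \<and> j \<in> C))"

definition zone_nonconstant :: "'a mat \<Rightarrow> nat set \<Rightarrow> nat set \<Rightarrow> bool" where
  "zone_nonconstant M R C \<longleftrightarrow>
     (\<exists>a \<in> elements_mat (submatrix M R C). \<exists>b \<in> elements_mat (submatrix M R C). a \<noteq> b)"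

definition singleton_partition :: "nat \<Rightarrow> mat_partition" where
  "singleton_partition n = ((\<lambda>i. {i}) ` {..<n}, (\<lambda>i. {i}) ` {..<n})"

definition merge_step :: "mat_partition \<Rightarrow> mat_partition \<Rightarrow> bool" where
  "merge_step P Q \<longleftrightarrow>
     (\<exists>R1 \<in> fst P. \<exists>R2 \<in> fst P. \<exists>C1 \<in> snd P. \<exists>C2 \<in> snd P.
        R1 \<noteq> R2 \<and> symmetric_to R1 C1 \<and> symmetric_to R2 C2 \<and>
        fst Q = insert (R1 \<union> R2) (fst P - {R1, R2}) \<and>
        snd Q = insert (C1 \<union> C2) (snd P - {C1, C2}))"

definition symmetric_partition_sequence :: "nat \<Rightarrow> mat_partition list \<Rightarrow> bool" where
  "symmetric_partition_sequence n Ps \<longleftrightarrow>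
     Ps \<noteq> [] \<and> (\<forall>P \<in> set Ps. symmetric_partition n P) \<and>
     hd Ps = singleton_partition n \<and>
     card (fst (last Ps)) = 1 \<and> card (snd (last Ps)) = 1 \<and>
     successively merge_step Ps"

text \<open>The span is only meaningful for finite nonempty sets, the only ones it is applied to below.\<close>

definition index_span :: "nat set \<Rightarrow> nat set" where
  "index_span X = {Min X..Max X}"

definition in_conflict :: "nat set \<Rightarrow> nat set \<Rightarrow> bool" where
  "in_conflict X Y \<longleftrightarrow> index_span X \<inter> index_span Y \<noteq> {}"

definition row_part_stretch :: "'a mat \<Rightarrow> mat_partition \<Rightarrow> nat set \<Rightarrow> nat" where
  "row_part_stretch M P R =
     card {C' \<in> snd P. in_conflict C' (\<Union>{C \<in> snd P. symmetric_to R C \<or> zone_nonconstant M R C})}"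

definition col_part_stretch :: "'a mat \<Rightarrow> mat_partition \<Rightarrow> nat set \<Rightarrow> nat" where
  "col_part_stretch M P C =
     card {R' \<in> fst P. in_conflict R' (\<Union>{R \<in> fst P. symmetric_to R C \<or> zone_nonconstant M R C})}"

definition partition_stretch :: "'a mat \<Rightarrow> mat_partition \<Rightarrow> nat" where
  "partition_stretch M P = Max (row_part_stretch M P ` fst P \<union> col_part_stretch M P ` snd P)"

text \<open>For a square matrix of positive dimension this is a minimum of natural numbers. The
  0 by 0 matrix has no symmetric partition sequence, and its stretch-width is \<open>\<infinity>\<close>.\<close>

definition stw :: "'a mat \<Rightarrow> enat" where
  "stw M = (INF Ps \<in> {Ps. symmetric_partition_sequence (dim_row M) Ps}.
              enat (Max (partition_stretch M ` set Ps)))"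

definition consecutive :: "nat set \<Rightarrow> bool" where
  "consecutive X \<longleftrightarrow> (\<exists>a b. X = {a..<b})"

definition listed_in_order :: "nat set list \<Rightarrow> bool" where
  "listed_in_order Xs \<longleftrightarrow> sorted_wrt (\<lambda>X Y. \<forall>x\<in>X. \<forall>y\<in>Y. x < y) Xs"

definition division :: "nat \<Rightarrow> nat set list \<Rightarrow> nat set list \<Rightarrow> bool" where
  "division n Rs Cs \<longleftrightarrow>
     symmetric_partition n (set Rs, set Cs) \<and>
     (\<forall>R \<in> set Rs. consecutive R) \<and> (\<forall>C \<in> set Cs. consecutive C) \<and>
     listed_in_order Rs \<and> listed_in_order Cs \<and>
     list_all2 symmetric_to Rs Cs"

text \<open>The \<open>k\<close> consecutive parts are those at positions \<open>j, \<dots>, j + k - 1\<close>. A submatrix without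
  columns but with at least one row has exactly one distinct row.\<close>

definition wide_row_part ::
  "nat \<Rightarrow> 'a mat \<Rightarrow> nat set list \<Rightarrow> nat set list \<Rightarrow> nat \<Rightarrow> bool" where
  "wide_row_part k M Rs Cs i \<longleftrightarrow>
     (\<forall>j. j \<le> i \<and> i < j + k \<and> j + k \<le> length Cs \<longrightarrow>
        k \<le> card (set (rows (submatrix M (Rs ! i) ({..<dim_col M} - (\<Union>l\<in>{j..<j + k}. Cs ! l))))))"

definition wide_col_part ::
  "nat \<Rightarrow> 'a mat \<Rightarrow> nat set list \<Rightarrow> nat set list \<Rightarrow> nat \<Rightarrow> bool" where
  "wide_col_part k M Rs Cs i \<longleftrightarrow>
     (\<forall>j. j \<le> i \<and> i < j + k \<and> j + k \<le> length Rs \<longrightarrow>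
        k \<le> card (set (cols (submatrix M ({..<dim_row M} - (\<Union>l\<in>{j..<j + k}. Rs ! l)) (Cs ! i)))))"

text \<open>If a division has fewer than \<open>k\<close> parts, there are no \<open>k\<close> consecutive parts and the
  condition on the individual parts is vacuous. Such a division does not count as \<open>k\<close>-wide:
  otherwise the division with a single part would be \<open>k\<close>-wide for all \<open>k \<ge> 2\<close> and every matrix.
  For \<open>k \<ge> 2\<close> this agrees with truncating the window \<open>C\<^sub>j, \<dots>, C\<^bsub>j+k-1\<^esub>\<close> at the borders of
  the matrix.\<close>

definition wide_division :: "nat \<Rightarrow> 'a mat \<Rightarrow> nat set list \<Rightarrow> nat set list \<Rightarrow> bool" where
  "wide_division k M Rs Cs \<longleftrightarrow>
     k \<le> length Rs \<and>
     (\<forall>i < length Rs. wide_row_part k M Rs Cs i) \<and>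
     (\<forall>i < length Cs. wide_col_part k M Rs Cs i)"

end

theory Submission
  imports Defs
begin

text \<open>
  For a part \<open>R\<close> of a partition in a sequence witnessing \<open>stw M \<le> k\<close>, let \<open>I R\<close> be the span of
  \<open>R\<close> and all parts having a non-constant zone with it. Along the sequence, no \<open>I R\<close> ever
  contains a part of a \<open>9 k\<close>-wide division. Indeed, if \<open>I R\<close> contains the division part \<open>D\<close> right after
  a merge, then at most \<open>k\<close> parts meet \<open>D\<close>, so at most \<open>k + 2\<close> parts met \<open>D\<close> before the merge.
  Before the merge, each \<open>I R'\<close> with \<open>R'\<close> meeting \<open>D\<close> contained no division part, hence lay within
  \<open>D\<close> and its two neighbours. Outside of these three parts the rows of \<open>D\<close> depend only on their part,
  so at most \<open>k + 2 < 9 k\<close> of them are distinct, against wideness. This contradicts the last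
  partition, whose single part covers everything.
\<close>

section \<open>Conflict sets and symmetric partitions\<close>

text \<open>The set whose span decides \<open>row_part_stretch\<close>:
  \<open>index_span (conflict_set M P R)\<close> is the \<open>I R\<close> above.\<close>

definition conflict_set :: "'a mat \<Rightarrow> mat_partition \<Rightarrow> nat set \<Rightarrow> nat set" where
  "conflict_set M P R = \<Union>{C \<in> snd P. symmetric_to R C \<or> zone_nonconstant M R C}"

lemma in_index_span: "finite X \<Longrightarrow> x \<in> X \<Longrightarrow> x \<in> index_span X"
  by (auto simp: index_span_def)

lemma index_span_convex:
  "x \<in> index_span X \<Longrightarrow> y \<in> index_span X \<Longrightarrow> x \<le> z \<Longrightarrow> z \<le> y \<Longrightarrow> z \<in> index_span X"
  by (auto simp: index_span_def)

text \<open>Both halves induce the same equivalence relation on indices, and a relation determines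
  its classes. Hence later arguments can work with \<open>fst P\<close>.\<close>

lemma symmetric_partition_eq:
  assumes P: "symmetric_partition n P"
  shows "snd P = fst P"
proof -
  \<comment> \<open>Stated for arbitrary \<open>A\<close> and \<open>B\<close> because it serves
    both inclusions.\<close>
  have subset: "A \<subseteq> B"
    if A: "partition_on {..<n} A" and B: "partition_on {..<n} B"
      and AB: "\<forall>i<n. \<forall>j<n. (\<exists>R\<in>A. i \<in> R \<and> j \<in> R) \<longleftrightarrow> (\<exists>C\<in>B. i \<in> C \<and> j \<in> C)"
    for A B
  proof
    fix R assume R: "R \<in> A"
    with A obtain i where i: "i \<in> R" "i < n"
      unfolding partition_on_def by (metis UnionI all_not_in_conv lessThan_iff)
    then obtain C where C: "C \<in> B" "i \<in> C"
      using B unfolding partition_on_def by (metis UnionE lessThan_iff)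
    have lt: "j < n" if "j \<in> R \<or> j \<in> C" for j
      using that R C A B unfolding partition_on_def by blast
    have "j \<in> R \<longleftrightarrow> j \<in> C" for j
    proof
      assume j: "j \<in> R"
      then obtain C' where "C' \<in> B" "i \<in> C'" "j \<in> C'"
        using AB R i lt by blast
      then show "j \<in> C"
        using B C unfolding partition_on_def disjoint_def by blast
    next
      assume j: "j \<in> C"
      then obtain R' where "R' \<in> A" "i \<in> R'" "j \<in> R'"
        using AB C i lt by blast
      then show "j \<in> R"
        using A R i unfolding partition_on_def disjoint_def by blast
    qed
    then have "R = C" by blast
    with C show "R \<in> B" by simp
  qed
  have "fst P \<subseteq> snd P"
    using P by (intro subset) (simp_all add: symmetric_partition_def)
  moreover have "snd P \<subseteq> fst P"
    using P by (intro subset) (simp_all add: symmetric_partition_def)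
  ultimately show ?thesis by blast
qed

lemma symmetric_partition_on: "symmetric_partition n P \<Longrightarrow> partition_on {..<n} (fst P)"
  by (simp add: symmetric_partition_def)

lemma partition_on_finite: "partition_on {..<n::nat} A \<Longrightarrow> finite A"
  by (rule finite_UnionD) (simp add: partition_on_def)

lemma partition_onE_mem:
  assumes "partition_on A P" "x \<in> A"
  obtains X where "X \<in> P" "x \<in> X"
  using assms by (auto simp: partition_on_def)

lemma subset_conflict_set:
  assumes "symmetric_partition n P" "R \<in> fst P"
  shows "R \<subseteq> conflict_set M P R"
  using assms symmetric_partition_eq[OF assms(1)] by (auto simp: conflict_set_def symmetric_to_def)

lemma finite_conflict_set:
  assumes "symmetric_partition n P"
  shows "finite (conflict_set M P R)"
proof (rule finite_subset)
  show "conflict_set M P R \<subseteq> {..<n}"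
    using assms by (auto simp: conflict_set_def symmetric_partition_def partition_on_def)
qed simp

section \<open>Submatrices and their distinct rows\<close>

lemma submatrix_element:
  assumes M: "M \<in> carrier_mat n m" and "I \<subseteq> {..<n}" "J \<subseteq> {..<m}" "i \<in> I" "j \<in> J"
  shows "M $$ (i, j) \<in> elements_mat (submatrix M I J)"
proof -
  \<comment> \<open>The position of an index in the submatrix is the number of smaller selected
    indices.\<close>
  let ?i = "card {a \<in> I. a < i}" and ?j = "card {a \<in> J. a < j}"
  have fin: "finite I" "finite J" using assms finite_subset by blast+
  have dims: "dim_row (submatrix M I J) = card I" "dim_col (submatrix M I J) = card J"
    using assms by (auto simp: dim_submatrix subset_iff intro!: arg_cong[where f = card])
  have "?i < card I" "?j < card J"
    using fin assms by (auto intro!: psubset_card_mono)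
  moreover have "M $$ (i, j) = submatrix M I J $$ (?i, ?j)"
    using assms by (subst submatrix_index_card) auto
  ultimately show ?thesis
    using dims by (intro elements_matI[of _ "card I" "card J" ?i ?j]) auto
qed

text \<open>The column part containing \<open>c\<close> is not among those collected in the conflict
  set, so its zone with \<open>R\<close> is constant.\<close>

lemma entries_eq_outside_conflict_set:
  assumes M: "M \<in> carrier_mat n n" and P: "symmetric_partition n P"
    and R: "R \<in> fst P" "a \<in> R" "b \<in> R" and c: "c < n" "c \<notin> conflict_set M P R"
  shows "M $$ (a, c) = M $$ (b, c)"
proof (rule ccontr)
  assume neq: "M $$ (a, c) \<noteq> M $$ (b, c)"
  obtain C where C: "C \<in> snd P" "c \<in> C"
    using P c by (auto simp: symmetric_partition_def elim: partition_onE_mem)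
  have "R \<subseteq> {..<n}" "C \<subseteq> {..<n}"
    using P R C by (auto simp: symmetric_partition_def partition_on_def)
  then have "zone_nonconstant M R C"
    using neq R C submatrix_element[OF M] unfolding zone_nonconstant_def by metis
  with C c show False by (auto simp: conflict_set_def)
qed

text \<open>Rows become values of a function of the original row index, so that distinct rows can be
  counted as an image of \<open>I\<close>.\<close>

lemma rows_submatrix:
  assumes "M \<in> carrier_mat n m" and "I \<subseteq> {..<n}"
  shows "set (rows (submatrix M I J)) =
    (\<lambda>a. vec (card {j. j < m \<and> j \<in> J}) (\<lambda>j. M $$ (a, pick J j))) ` I"
    (is "_ = ?f ` I")
proof -
  have I: "{i. i < dim_row M \<and> i \<in> I} = I" using assms by auto
  have fin: "finite I" using assms finite_subset by blast
  have row: "row (submatrix M I J) i = ?f (pick I i)" if "i < card I" for i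
    using that assms I by (intro eq_vecI) (auto simp: dim_submatrix submatrix_index)
  have "set (rows (submatrix M I J)) = row (submatrix M I J) ` {..<card I}"
    by (auto simp: rows_def dim_submatrix I lessThan_atLeast0)
  also have "\<dots> = ?f ` pick I ` {..<card I}"
    unfolding image_image using row by (intro image_cong) auto
  also have "pick I ` {..<card I} = I"
  proof (intro equalityI subsetI)
    fix i assume i: "i \<in> I"
    then have "card {a \<in> I. a < i} < card I"
      using fin by (auto intro!: psubset_card_mono)
    with pick_card_in_set[OF i] show "i \<in> pick I ` {..<card I}"
      by (intro image_eqI[of _ _ "card {a \<in> I. a < i}"]) simp_all
  qed (auto simp: pick_in_set_le)
  finally show ?thesis .
qed

text \<open>Each part meeting \<open>D\<close> contributes a single value, taken at a chosen
  representative.\<close>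

lemma card_image_le_parts:
  assumes "finite P" "D \<subseteq> \<Union>P"
    and const: "\<And>X a b. X \<in> P \<Longrightarrow> a \<in> X \<inter> D \<Longrightarrow> b \<in> X \<inter> D \<Longrightarrow> f a = f b"
  shows "card (f ` D) \<le> card {X \<in> P. X \<inter> D \<noteq> {}}"
proof -
  have "f ` D \<subseteq> (\<lambda>X. f (SOME a. a \<in> X \<inter> D)) ` {X \<in> P. X \<inter> D \<noteq> {}}"
  proof clarify
    fix a assume a: "a \<in> D"
    with assms obtain X where X: "X \<in> P" "a \<in> X" by blast
    then have "(SOME b. b \<in> X \<inter> D) \<in> X \<inter> D"
      using a by (intro someI[of "\<lambda>b. b \<in> X \<inter> D" a]) auto
    then have "f a = f (SOME b. b \<in> X \<inter> D)" using const X a by blast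
    with X a show "f a \<in> (\<lambda>X. f (SOME a. a \<in> X \<inter> D)) ` {X \<in> P. X \<inter> D \<noteq> {}}" by blast
  qed
  with \<open>finite P\<close> show ?thesis by (simp add: surj_card_le)
qed

lemma card_rows_submatrix_le:
  assumes M: "M \<in> carrier_mat n n" and P: "symmetric_partition n P" and D: "D \<subseteq> {..<n}"
    and out: "\<And>X a b c. X \<in> fst P \<Longrightarrow> a \<in> X \<inter> D \<Longrightarrow> b \<in> X \<inter> D \<Longrightarrow> c < n \<Longrightarrow> c \<in> J
      \<Longrightarrow> M $$ (a, c) = M $$ (b, c)"
  shows "card (set (rows (submatrix M D J))) \<le> card {X \<in> fst P. X \<inter> D \<noteq> {}}"
  unfolding rows_submatrix[OF M D]
proof (rule card_image_le_parts)
  show "finite (fst P)" "D \<subseteq> \<Union>(fst P)"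
    using symmetric_partition_on[OF P] D by (auto simp: partition_on_finite partition_on_def)
  fix X a b assume X: "X \<in> fst P" "a \<in> X \<inter> D" "b \<in> X \<inter> D"
  show "vec (card {j. j < n \<and> j \<in> J}) (\<lambda>j. M $$ (a, pick J j)) =
    vec (card {j. j < n \<and> j \<in> J}) (\<lambda>j. M $$ (b, pick J j))"
  proof (intro eq_vecI)
    fix j assume "j < dim_vec (vec (card {j. j < n \<and> j \<in> J}) (\<lambda>j. M $$ (b, pick J j)))"
    then have "j < card {j. j < n \<and> j \<in> J}" by simp
    \<comment> \<open>\<open>J\<close> may exceed \<open>{..<n}\<close>; below this cardinality,
      picks from \<open>J\<close> agree with picks from its truncation.\<close>
    then have "pick J j \<in> {j. j < n \<and> j \<in> J}"
      by (metis pick_in_set_le pick_reduce_set)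
    then show "vec (card {j. j < n \<and> j \<in> J}) (\<lambda>j. M $$ (a, pick J j)) $ j =
      vec (card {j. j < n \<and> j \<in> J}) (\<lambda>j. M $$ (b, pick J j)) $ j"
      using out[OF X] \<open>j < card _\<close> by simp
  qed simp
qed

section \<open>Counting the parts that meet a set of indices\<close>

text \<open>A point of \<open>X \<inter> D\<close> lies in the span of \<open>X\<close> and in that
  of the conflict set, so \<open>X\<close> is counted by \<open>row_part_stretch\<close>.\<close>

lemma card_parts_meeting_le_stretch:
  assumes P: "symmetric_partition n P" and R: "R \<in> fst P" and D: "D \<subseteq> {..<n}"
    and sub: "D \<subseteq> index_span (conflict_set M P R)"
  shows "card {X \<in> fst P. X \<inter> D \<noteq> {}} \<le> partition_stretch M P"
proof -
  have part: "partition_on {..<n} (fst P)" and eq: "snd P = fst P"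
    using P symmetric_partition_eq symmetric_partition_on by blast+
  note fin = partition_on_finite[OF part]
  have finX: "finite X" if "X \<in> fst P" for X
    using that part by (metis finite_lessThan finite_subset Sup_upper partition_on_def)
  have "{X \<in> fst P. X \<inter> D \<noteq> {}} \<subseteq> {X \<in> snd P. in_conflict X (conflict_set M P R)}"
    using sub finX in_index_span unfolding in_conflict_def eq by blast
  then have "card {X \<in> fst P. X \<inter> D \<noteq> {}} \<le> row_part_stretch M P R"
    unfolding row_part_stretch_def conflict_set_def[symmetric] by (rule card_mono[rotated]) (simp add: eq fin)
  also have "\<dots> \<le> partition_stretch M P"
    unfolding partition_stretch_def using R fin by (intro Max_ge) (auto simp: eq)
  finally show ?thesis .
qed

text \<open>Only the two merged parts can be missing from \<open>fst Q\<close>.\<close>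

lemma card_parts_meeting_merge_step:
  assumes "merge_step P Q" and "finite (fst P)"
  shows "card {X \<in> fst P. X \<inter> D \<noteq> {}} \<le> card {X \<in> fst Q. X \<inter> D \<noteq> {}} + 2"
proof -
  obtain R1 R2 where Q: "fst Q = insert (R1 \<union> R2) (fst P - {R1, R2})"
    using assms by (auto simp: merge_step_def)
  have fin: "finite (fst Q)" using assms Q by simp
  have "{X \<in> fst P. X \<inter> D \<noteq> {}} \<subseteq> {X \<in> fst Q. X \<inter> D \<noteq> {}} \<union> {R1, R2}"
    unfolding Q by auto
  then have "card {X \<in> fst P. X \<inter> D \<noteq> {}} \<le> card ({X \<in> fst Q. X \<inter> D \<noteq> {}} \<union> {R1, R2})"
    using fin by (intro card_mono) auto
  also have "\<dots> \<le> card {X \<in> fst Q. X \<inter> D \<noteq> {}} + card {R1, R2}" by (rule card_Un_le)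
  also have "card {R1, R2} \<le> 2" by (simp add: card_insert_if)
  finally show ?thesis by simp
qed

section \<open>Consequences of a stretch-width bound\<close>

lemma stw_le_witness:
  assumes "stw M \<le> enat k"
  obtains Ps where "symmetric_partition_sequence (dim_row M) Ps"
    and "\<And>P. P \<in> set Ps \<Longrightarrow> partition_stretch M P \<le> k"
proof -
  \<comment> \<open>A strict bound lets \<open>INF_less_iff\<close> produce a sequence without
    showing that the infimum is attained.\<close>
  have "stw M < enat (Suc k)"
    using assms by (rule order_le_less_trans) simp
  then obtain Ps where Ps: "symmetric_partition_sequence (dim_row M) Ps"
    "Max (partition_stretch M ` set Ps) \<le> k"
    unfolding stw_def INF_less_iff by auto
  show ?thesis
  proof (rule that)
    show "symmetric_partition_sequence (dim_row M) Ps" by fact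
    fix P assume "P \<in> set Ps"
    then have "partition_stretch M P \<le> Max (partition_stretch M ` set Ps)" by simp
    with Ps show "partition_stretch M P \<le> k" by simp
  qed
qed

text \<open>Rules out \<open>k = 0\<close> in the theorem, where every division would be
  \<open>0\<close>-wide. A single index of \<open>R\<close> serves as the set \<open>D\<close> in
  the stretch bound.\<close>

lemma partition_stretch_pos:
  assumes P: "symmetric_partition n P" and R: "R \<in> fst P"
  shows "0 < partition_stretch M P"
proof -
  have part: "partition_on {..<n} (fst P)" using P symmetric_partition_on by blast
  obtain x where x: "x \<in> R" "x < n"
    using part R by (metis UnionI all_not_in_conv lessThan_iff partition_on_def)
  have "0 < card {X \<in> fst P. X \<inter> {x} \<noteq> {}}"
    using x R partition_on_finite[OF part] by (auto simp: card_gt_0_iff)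
  also have "\<dots> \<le> partition_stretch M P"
    using P R x finite_conflict_set subset_conflict_set
    by (intro card_parts_meeting_le_stretch[of n]) (blast intro!: in_index_span)+
  finally show ?thesis .
qed

section \<open>Spans across the parts of a division\<close>

lemma listed_in_order_nth:
  assumes "listed_in_order Ds" "i < j" "j < length Ds" "x \<in> Ds ! i" "y \<in> Ds ! j"
  shows "x < y"
  using assms sorted_wrt_nth_less[of _ Ds i j] unfolding listed_in_order_def by blast

text \<open>If two division parts at distance at least two met the span, convexity would put every
  part between them inside it.\<close>

lemma ordered_span_within_neighbours:
  assumes order: "listed_in_order Ds"
    and no: "\<And>j. j < length Ds \<Longrightarrow> \<not> Ds ! j \<subseteq> index_span X"
    and i: "i < length Ds" "y \<in> Ds ! i" "y \<in> index_span X"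
    and j: "j < length Ds" "x \<in> Ds ! j" "x \<in> index_span X"
  shows "i \<le> Suc j" and "j \<le> Suc i"
proof -
  have gap: "b \<le> Suc a"
    if "a < length Ds" "u \<in> Ds ! a" "u \<in> index_span X"
      and "b < length Ds" "v \<in> Ds ! b" "v \<in> index_span X" for a b u v
  proof (rule ccontr)
    assume "\<not> b \<le> Suc a"
    then have b: "Suc a < b" by simp
    then have len: "Suc a < length Ds" using that(4) by simp
    have "Ds ! Suc a \<subseteq> index_span X"
    proof
      fix z assume z: "z \<in> Ds ! Suc a"
      have "u < z" by (rule listed_in_order_nth[OF order lessI len that(2) z])
      moreover have "z < v" by (rule listed_in_order_nth[OF order b that(4) z that(5)])
      ultimately show "z \<in> index_span X"
        using index_span_convex[OF that(3,6)] by simp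
    qed
    with no[OF len] show False by simp
  qed
  show "i \<le> Suc j" by (rule gap[OF j i])
  show "j \<le> Suc i" by (rule gap[OF i j])
qed

section \<open>Induction along the partition sequence\<close>

text \<open>Reverse induction makes the hypothesis speak of the partition just before the last
  merge. The bound \<open>k + 2\<close> counts at most \<open>k\<close> parts after the merge and
  two that it may have removed.\<close>

lemma conflict_span_contains_no_wide_part:
  assumes M: "M \<in> carrier_mat n n"
    and part: "partition_on {..<n} (set Ds)" and order: "listed_in_order Ds"
    and len: "K \<le> length Ds" and K: "k + 2 < K"
    and wide: "\<And>i. i < length Ds \<Longrightarrow> wide_row_part K M Ds Ds i"
    and stretch: "\<And>P. P \<in> set Ps \<Longrightarrow> partition_stretch M P \<le> k"
    and sym: "\<And>P. P \<in> set Ps \<Longrightarrow> symmetric_partition n P"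
    and "Ps \<noteq> []" "hd Ps = singleton_partition n" "successively merge_step Ps"
    and "R \<in> fst (last Ps)" "i < length Ds"
  shows "\<not> Ds ! i \<subseteq> index_span (conflict_set M (last Ps) R)"
  using stretch sym assms(9-)
proof (induction Ps arbitrary: R i rule: rev_induct)
  case Nil
  then show ?case by simp
next
  case (snoc Q Ps)
  let ?D = "Ds ! i"
  have i: "i < length Ds" by fact
  have D: "?D \<subseteq> {..<n}"
    using part i unfolding partition_on_def by (metis Sup_upper nth_mem)
  have symQ: "symmetric_partition n Q" and leQ: "partition_stretch M Q \<le> k"
    using snoc.prems by auto
  \<comment> \<open>The window starts one part before \<open>i\<close>, truncated subtraction
    covering \<open>i = 0\<close>, and is shifted back if it would pass the end. As
    \<open>K \<ge> 3\<close>, it contains \<open>i\<close> and its existing neighbours.\<close>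
  define j where "j = min (i - 1) (length Ds - K)"
  have j: "j \<le> i" "i < j + K" "j + K \<le> length Ds" "j \<le> i - 1" "Suc i < length Ds \<Longrightarrow> Suc i < j + K"
    using i len K by (auto simp: j_def)
  define J where "J = {..<n} - (\<Union>l\<in>{j..<j + K}. Ds ! l)"
  have ge: "K \<le> card (set (rows (submatrix M ?D J)))"
    using wide[OF i] j M by (auto simp: wide_row_part_def J_def)
  show ?case
  proof
    assume "?D \<subseteq> index_span (conflict_set M (last (Ps @ [Q])) R)"
    then have leD: "card {X \<in> fst Q. X \<inter> ?D \<noteq> {}} \<le> k"
      using card_parts_meeting_le_stretch[OF symQ _ D, of R M] snoc.prems(6) leQ by (metis last_snoc order_trans)
    have "card (set (rows (submatrix M ?D J))) \<le> k + 2"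
    proof (cases "Ps = []")
      case True
      \<comment> \<open>Before any merge the parts are singletons, so rows in a common part agree
        trivially.\<close>
      then have "Q = singleton_partition n" using snoc.prems by simp
      then have "card (set (rows (submatrix M ?D J))) \<le> card {X \<in> fst Q. X \<inter> ?D \<noteq> {}}"
        by (intro card_rows_submatrix_le[OF M symQ D]) (auto simp: singleton_partition_def)
      with leD show ?thesis by simp
    next
      case False
      define P where "P = last Ps"
      have PPs: "P \<in> set Ps" using False by (simp add: P_def)
      then have symP: "symmetric_partition n P" using snoc.prems by simp
      have step: "merge_step P Q" and succ: "successively merge_step Ps"
        using snoc.prems False by (auto simp: P_def successively_append_iff)
      \<comment> \<open>Every part \<open>X\<close> and every division part \<open>l\<close> must be
        covered, hence the generalised \<open>R\<close> and \<open>i\<close> in the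
        induction.\<close>
      have no: "\<not> Ds ! l \<subseteq> index_span (conflict_set M P X)"
        if "X \<in> fst P" "l < length Ds" for X l
        unfolding P_def using that snoc.prems False succ
        by (intro snoc.IH) (auto simp: P_def)
      have "card (set (rows (submatrix M ?D J))) \<le> card {X \<in> fst P. X \<inter> ?D \<noteq> {}}"
      proof (rule card_rows_submatrix_le[OF M symP D])
        fix X a b c
        assume X: "X \<in> fst P" "a \<in> X \<inter> ?D" "b \<in> X \<inter> ?D" and c: "c < n" "c \<in> J"
        note fin = finite_conflict_set[OF symP, of M X]
        \<comment> \<open>With \<open>a\<close> and \<open>c\<close> in one span, the division part
          of \<open>c\<close> would be \<open>?D\<close> or a neighbour, inside the window that
          \<open>J\<close> leaves out.\<close>
        have "c \<notin> conflict_set M P X"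
        proof
          assume "c \<in> conflict_set M P X"
          then have cI: "c \<in> index_span (conflict_set M P X)" using fin in_index_span by blast
          have aI: "a \<in> index_span (conflict_set M P X)"
            using fin in_index_span subset_conflict_set[OF symP X(1)] X(2) by blast
          obtain l where l: "l < length Ds" "c \<in> Ds ! l"
            using part c by (metis in_set_conv_nth lessThan_iff partition_onE_mem)
          have "i \<le> Suc l" "l \<le> Suc i"
            using ordered_span_within_neighbours[OF order no[OF X(1)] i _ aI l cI] X by auto
          then have "l \<in> {j..<j + K}" using j l by (cases "l = Suc i") auto
          with l c show False by (auto simp: J_def)
        qed
        then show "M $$ (a, c) = M $$ (b, c)"
          using entries_eq_outside_conflict_set[OF M symP] X c by blast
      qed
      also have "\<dots> \<le> card {X \<in> fst Q. X \<inter> ?D \<noteq> {}} + 2"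
        by (rule card_parts_meeting_merge_step[OF step
              partition_on_finite[OF symmetric_partition_on[OF symP]]])
      finally show ?thesis using leD by simp
    qed
    with ge K show False by simp
  qed
qed

theorem theorem18:
  fixes M :: "'a :: zero_neq_one mat" and n k :: nat
  assumes "M \<in> carrier_mat n n"
    and "zero_one_mat M"
    and "symmetric_mat M"
    and "stw M \<le> enat k"
  shows "\<not> (\<exists>Rs Cs. division n Rs Cs \<and> wide_division (9 * k) M Rs Cs)"
proof clarify
  fix Rs Cs assume div: "division n Rs Cs" and wide: "wide_division (9 * k) M Rs Cs"
  have "Cs = Rs"
    using div by (auto simp: division_def symmetric_to_def list_all2_conv_all_nth intro: nth_equalityI)
  with div wide have part: "partition_on {..<n} (set Rs)" and order: "listed_in_order Rs"
    and len: "9 * k \<le> length Rs"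
    and wide: "\<And>i. i < length Rs \<Longrightarrow> wide_row_part (9 * k) M Rs Rs i"
    by (auto simp: division_def symmetric_partition_def wide_division_def)
  obtain Ps where seq: "symmetric_partition_sequence (dim_row M) Ps"
    and stretch: "\<And>P. P \<in> set Ps \<Longrightarrow> partition_stretch M P \<le> k"
    using stw_le_witness assms by blast
  have Ps: "Ps \<noteq> []" "hd Ps = singleton_partition n" "successively merge_step Ps"
    and sym: "\<And>P. P \<in> set Ps \<Longrightarrow> symmetric_partition n P"
    and card1: "card (fst (last Ps)) = 1"
    using seq assms by (auto simp: symmetric_partition_sequence_def)
  obtain R where R: "fst (last Ps) = {R}" using card1 card_1_singletonE by blast
  have symL: "symmetric_partition n (last Ps)" using sym Ps by simp
  have "0 < partition_stretch M (last Ps)"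
    using partition_stretch_pos[OF symL, of R M] R by simp
  with stretch Ps have "0 < k" by (metis last_in_set le_0_eq neq0_conv)
  \<comment> \<open>The only part of the last partition is the whole index set, so its span contains
    any division part, for instance the first.\<close>
  have "R = {..<n}"
    using symmetric_partition_on[OF symL] R by (simp add: partition_on_def)
  moreover have "Rs ! 0 \<subseteq> {..<n}"
    using part len \<open>0 < k\<close> unfolding partition_on_def
    by (metis Sup_upper nth_mem less_le_trans nat_0_less_mult_iff zero_less_numeral)
  moreover have "R \<subseteq> conflict_set M (last Ps) R"
    using subset_conflict_set[OF symL, of R M] R by simp
  ultimately have "Rs ! 0 \<subseteq> index_span (conflict_set M (last Ps) R)"
    using in_index_span[OF finite_conflict_set[OF symL]] by blast
  \<comment> \<open>\<open>0 < k\<close> makes \<open>Rs\<close> nonempty and gives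
    \<open>k + 2 < 9 * k\<close>.\<close>
  moreover have "\<not> Rs ! 0 \<subseteq> index_span (conflict_set M (last Ps) R)"
    using len \<open>0 < k\<close> R
    by (intro conflict_span_contains_no_wide_part
          [OF assms(1) part order len _ wide stretch sym Ps]) auto
  ultimately show False by simp
qed

end
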